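(* Let $G$ be a connected graph and let $\mathbf{T}\in\mathit{Ter}(\mathcal{B}(t))$. Then $\mathcal{G}(\mathbf{T})$ is isomorphic to $G$ if and only if $|V_{\mathcal{G}(\mathbf{T})}|=|V_G|$ and there exists a $(G,t)$-concrete tree decomposition $\hat{\mathbf{T}}\in\mathit{Ter}(\mathcal{B}(G,t))$ such that $\mathbf{T}=\pi(\hat{\mathbf{T}})$.
   Context: Graphs: a graph is a triple $G=(V_G,E_G,\mathrm{Inc}_G)$ with finite vertex set, finite edge set and $\mathrm{Inc}_G\subseteq E_G\times V_G$; $\mathit{endpts}(e)=\{v\mid(e,v)\in\mathrm{Inc}_G\}$ has size $0$ or $2$ (multiple edges allowed, no loops). Degree of $v$ = number of edges incident with $v$; $\Delta(G)$ = maximum degree. Connected means any two vertices are joined by a path. An isomorphism $G\to H$ is a pair of bijections $V_G\to V_H$, $E_G\to E_H$ such that if $\mathit{endpts}(e)=\{v,v'\}$ then the image edge has endpoints the images of $v,v'$. Terms: for a finite alphabet $\Sigma$, $\mathit{Ter}(\Sigma)$ is the smallest set with $a$, $a(t_1)$, $a(t_1,t_2)\in\mathit{Ter}(\Sigma)$ for $a\in\Sigma$. Positions: $\mathit{Pos}(a(t_1,\dots,t_r))=\{\lambda\}\cup\bigcup_{j\le r}\{jp\mid p\in\mathit{Pos}(t_j)\}$; $pj$ is a child of $p$ (and $p$ its parent); $t[p]$ is the symbol at $p$; a set of positions is connected if it induces a connected subtree of the tree with arcs $\{p,pj\}$. A $t$-concrete bag is $(B,b)$ with $B\subseteq\{1,\dots,t\}$,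 $b\subseteq B$, $b=\emptyset$ or $|b|=2$; $\mathcal{B}(t)$ is their set; for $\mathbf{T}\in\mathit{Ter}(\mathcal{B}(t))$ write $\mathbf{T}[p]=(\mathbf{T}[p].B,\mathbf{T}[p].b)$. For $s\in[t]$, a nonempty $P\subseteq\mathit{Pos}(\mathbf{T})$ is $s$-maximal if it is connected, $s\in\mathbf{T}[p].B$ for all $p\in P$, and every connected $P'$ with this property satisfies $P\cap P'=\emptyset$ or $P'\subseteq P$; $P(p,s)$ is the $s$-maximal set containing $p$. $\mathcal{G}(\mathbf{T})$ has vertices $v_{s,P}$ ($P$ $s$-maximal), edges $e_p$ ($\mathbf{T}[p].b\neq\emptyset$) and incidences $(e_p,v_{s,P(p,s)})$ for $s\in\mathbf{T}[p].b$. $(G,t)$-concrete bags: tuples $(B,b,\nu,\eta,y,\rho)$ where $(B,b)\in\mathcal{B}(t)$; $\nu:B\to V_G$ is injective; $\eta$ assigns to each $s\in B$ a set of at most $\Delta(G)$ edges incident with $\nu(s)$; $y\subseteq E_G$ with $|y|\le1$ and $y\subseteq\eta(s)$ whenever $s\in b$; and $\rho\subseteq B$. $\mathcal{B}(G,t)$ is the set of these. A term $\hat{\mathbf{T}}\in\mathit{Ter}(\mathcal{B}(G,t))$ (components written $\hat{\mathbf{T}}[p].B$, etc.) is a $(G,t)$-concrete tree decomposition if for every position $p$ and every $s\in[t]$: (C1) if $pj$ is a position and $s\in\hat{\mathbf{T}}[p].B\cap\hat{\mathbf{T}}[pj].B$ then $\hat{\mathbf{T}}[p].\nu(s)=\hat{\mathbf{T}}[pj].\nu(s)$;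 (C2) if $\hat{\mathbf{T}}[p].b=\{s,s'\}$ then $\hat{\mathbf{T}}[p].y=\{e\}$ for an edge $e$ with $\mathit{endpts}(e)=\{\hat{\mathbf{T}}[p].\nu(s),\hat{\mathbf{T}}[p].\nu(s')\}$; (C3) if $p1,\dots,pr$ ($r\in\{0,1,2\}$) are the children of $p$, then $\hat{\mathbf{T}}[p].\eta(s)$ is the disjoint union of $\hat{\mathbf{T}}[p].y,\hat{\mathbf{T}}[p1].\eta(s),\dots,\hat{\mathbf{T}}[pr].\eta(s)$; (C4) if $s\in\hat{\mathbf{T}}[p].\rho$ then $\hat{\mathbf{T}}[p].\eta(s)$ is the set of all edges incident with $\hat{\mathbf{T}}[p].\nu(s)$; (C5) $\hat{\mathbf{T}}[\lambda].\rho=\hat{\mathbf{T}}[\lambda].B$, and if $pj$ is a position then $s\in\hat{\mathbf{T}}[pj].\rho$ iff $s\in\hat{\mathbf{T}}[pj].B$ and $s\notin\hat{\mathbf{T}}[p].B$. $\pi:\mathcal{B}(G,t)\to\mathcal{B}(t)$ maps $(B,b,\nu,\eta,y,\rho)\mapsto(B,b)$, extended to terms positionwise.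
   Formalization: In (C3) the set y is counted at s only when s is in b, and (C3) is required only for s in B (as literally stated the equivalence is false); also every edge of G is assumed to have two endpoints, since an endpoint-free edge of G breaks the equivalence. *)

theory Defs
  imports Main "HOL-Library.FuncSet" "HOL-Library.Disjoint_Sets"
begin

record ('v, 'e) ugraph =
  verts :: "'v set"
  edges :: "'e set"
  inc :: "('e \<times> 'v) set"

definition endpts :: "('v, 'e) ugraph \<Rightarrow> 'e \<Rightarrow> 'v set" where
  "endpts G e = {v. (e, v) \<in> inc G}"

definition is_graph :: "('v, 'e) ugraph \<Rightarrow> bool" where
  "is_graph G \<longleftrightarrow>
     finite (verts G) \<and> finite (edges G) \<and> inc G \<subseteq> edges G \<times> verts G \<and>
     (\<forall>e\<in>edges G. card (endpts G e) = 0 \<or> card (endpts G e) = 2)"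

definition incident_edges :: "('v, 'e) ugraph \<Rightarrow> 'v \<Rightarrow> 'e set" where
  "incident_edges G v = {e \<in> edges G. (e, v) \<in> inc G}"

definition deg :: "('v, 'e) ugraph \<Rightarrow> 'v \<Rightarrow> nat" where
  "deg G v = card (incident_edges G v)"

text \<open>The value is 0 for the graph without vertices.\<close>

definition max_deg :: "('v, 'e) ugraph \<Rightarrow> nat" where
  "max_deg G = Max (insert 0 (deg G ` verts G))"

definition adjacent :: "('v, 'e) ugraph \<Rightarrow> 'v \<Rightarrow> 'v \<Rightarrow> bool" where
  "adjacent G u v \<longleftrightarrow> (\<exists>e\<in>edges G. endpts G e = {u, v})"

definition is_path :: "('v, 'e) ugraph \<Rightarrow> 'v list \<Rightarrow> bool" where
  "is_path G vs \<longleftrightarrow>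
     vs \<noteq> [] \<and> set vs \<subseteq> verts G \<and> distinct vs \<and> successively (adjacent G) vs"

definition connected_graph :: "('v, 'e) ugraph \<Rightarrow> bool" where
  "connected_graph G \<longleftrightarrow>
     (\<forall>u\<in>verts G. \<forall>v\<in>verts G. \<exists>vs. is_path G vs \<and> hd vs = u \<and> last vs = v)"

definition isomorphism ::
  "('v, 'e) ugraph \<Rightarrow> ('w, 'f) ugraph \<Rightarrow> ('v \<Rightarrow> 'w) \<Rightarrow> ('e \<Rightarrow> 'f) \<Rightarrow> bool" where
  "isomorphism G H f g \<longleftrightarrow>
     bij_betw f (verts G) (verts H) \<and> bij_betw g (edges G) (edges H) \<and>
     (\<forall>e\<in>edges G. \<forall>v v'. endpts G e = {v, v'} \<longrightarrow> endpts H (g e) = {f v, f v'})"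

definition isomorphic :: "('v, 'e) ugraph \<Rightarrow> ('w, 'f) ugraph \<Rightarrow> bool" where
  "isomorphic G H \<longleftrightarrow> (\<exists>f g. isomorphism G H f g)"

datatype 'a ter = Leaf 'a | Unary 'a "'a ter" | Binary 'a "'a ter" "'a ter"

definition Ter :: "'a set \<Rightarrow> 'a ter set" where
  "Ter \<Sigma> = {T. set_ter T \<subseteq> \<Sigma>}"

fun Pos :: "'a ter \<Rightarrow> nat list set" where
  "Pos (Leaf a) = {[]}"
| "Pos (Unary a t) = {[]} \<union> {1 # p |p. p \<in> Pos t}"
| "Pos (Binary a t u) = {[]} \<union> {1 # p |p. p \<in> Pos t} \<union> {2 # p |p. p \<in> Pos u}"

text \<open>The symbol at a position; the value is meaningful only for positions of the term.\<close>

fun sym_at :: "'a ter \<Rightarrow> nat list \<Rightarrow> 'a" where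
  "sym_at (Leaf a) p = a"
| "sym_at (Unary a t) [] = a"
| "sym_at (Unary a t) (j # p) = sym_at t p"
| "sym_at (Binary a t u) [] = a"
| "sym_at (Binary a t u) (j # p) = (if j = 1 then sym_at t p else sym_at u p)"

definition children :: "'a ter \<Rightarrow> nat list \<Rightarrow> nat list set" where
  "children T p = {q \<in> Pos T. \<exists>j. q = p @ [j]}"

definition induced_tree :: "nat list set \<Rightarrow> (nat list, nat list set) ugraph" where
  "induced_tree P =
     (let A = {{p, p @ [j]} |p j. p \<in> P \<and> p @ [j] \<in> P}
      in \<lparr>verts = P, edges = A, inc = {(a, p). a \<in> A \<and> p \<in> a}\<rparr>)"

definition connected_pos :: "nat list set \<Rightarrow> bool" where
  "connected_pos P \<longleftrightarrow> connected_graph (induced_tree P)"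

record cbag =
  bagB :: "nat set"
  bagb :: "nat set"

definition cbags :: "nat \<Rightarrow> cbag set" where
  "cbags t = {c. bagB c \<subseteq> {1..t} \<and> bagb c \<subseteq> bagB c \<and> (bagb c = {} \<or> card (bagb c) = 2)}"

definition s_connected :: "cbag ter \<Rightarrow> nat \<Rightarrow> nat list set \<Rightarrow> bool" where
  "s_connected T s P \<longleftrightarrow>
     P \<subseteq> Pos T \<and> connected_pos P \<and> (\<forall>p\<in>P. s \<in> bagB (sym_at T p))"

definition s_maximal :: "cbag ter \<Rightarrow> nat \<Rightarrow> nat list set \<Rightarrow> bool" where
  "s_maximal T s P \<longleftrightarrow>
     P \<noteq> {} \<and> s_connected T s P \<and> (\<forall>P'. s_connected T s P' \<longrightarrow> P \<inter> P' = {} \<or> P' \<subseteq> P)"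

definition max_set :: "cbag ter \<Rightarrow> nat list \<Rightarrow> nat \<Rightarrow> nat list set" where
  "max_set T p s = (THE P. s_maximal T s P \<and> p \<in> P)"

text \<open>
  The vertex \<open>v\<^bsub>s,P\<^esub>\<close> is the pair \<open>(s, P)\<close> and the edge \<open>e\<^sub>p\<close> is the position \<open>p\<close>.
  For terms over \<open>cbags t\<close>, an \<open>s\<close>-maximal set exists only if \<open>s \<in> {1..t}\<close>, so \<open>t\<close> need
  not be mentioned.
\<close>

definition graph_of :: "cbag ter \<Rightarrow> (nat \<times> nat list set, nat list) ugraph" where
  "graph_of T =
     \<lparr>verts = {(s, P). s_maximal T s P},
      edges = {p \<in> Pos T. bagb (sym_at T p) \<noteq> {}},
      inc = {(p, (s, max_set T p s)) |p s. p \<in> Pos T \<and> s \<in> bagb (sym_at T p)}\<rparr>"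

record ('v, 'e) gbag = cbag +
  bagnu :: "nat \<Rightarrow> 'v"
  bageta :: "nat \<Rightarrow> 'e set"
  bagy :: "'e set"
  bagrho :: "nat set"

text \<open>
  The functions \<open>\<nu>\<close> and \<open>\<eta>\<close> have domain \<open>B\<close>. Outside \<open>B\<close> they take fixed values:
  \<open>undefined\<close> for \<open>\<nu>\<close>, and the empty set for \<open>\<eta>\<close>.
\<close>

definition gbags :: "('v, 'e) ugraph \<Rightarrow> nat \<Rightarrow> ('v, 'e) gbag set" where
  "gbags G t = {c.
     cbag.truncate c \<in> cbags t \<and>
     bagnu c \<in> bagB c \<rightarrow>\<^sub>E verts G \<and> inj_on (bagnu c) (bagB c) \<and>
     (\<forall>s\<in>bagB c. bageta c s \<subseteq> incident_edges G (bagnu c s) \<and> card (bageta c s) \<le> max_deg G) \<and>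
     (\<forall>s. s \<notin> bagB c \<longrightarrow> bageta c s = {}) \<and>
     bagy c \<subseteq> edges G \<and> card (bagy c) \<le> 1 \<and> (\<forall>s\<in>bagb c. bagy c \<subseteq> bageta c s) \<and>
     bagrho c \<subseteq> bagB c}"

definition cond1 :: "('v, 'e) gbag ter \<Rightarrow> nat list \<Rightarrow> nat \<Rightarrow> bool" where
  "cond1 T p s \<longleftrightarrow>
     (\<forall>q\<in>children T p. s \<in> bagB (sym_at T p) \<inter> bagB (sym_at T q) \<longrightarrow>
        bagnu (sym_at T p) s = bagnu (sym_at T q) s)"

definition cond2 :: "('v, 'e) ugraph \<Rightarrow> ('v, 'e) gbag ter \<Rightarrow> nat list \<Rightarrow> nat \<Rightarrow> bool" where
  "cond2 G T p s \<longleftrightarrow>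
     (\<forall>s'. bagb (sym_at T p) = {s, s'} \<longrightarrow>
        (\<exists>e\<in>edges G. bagy (sym_at T p) = {e} \<and>
           endpts G e = {bagnu (sym_at T p) s, bagnu (sym_at T p) s'}))"

text \<open>
  The edge in \<open>y\<close> joins the images of the two elements of \<open>b\<close>, so it is counted at \<open>s\<close> only
  if \<open>s \<in> b\<close>. Counting it at every \<open>s \<in> B\<close> would force \<open>B = b\<close> whenever \<open>b \<noteq> {}\<close>, because
  \<open>\<eta>(s)\<close> consists of edges incident with \<open>\<nu>(s)\<close> and \<open>\<nu>\<close> is injective. The condition
  applies where \<open>\<eta>(s)\<close> is defined, that is, for \<open>s \<in> B\<close>; children whose bag does not contain
  \<open>s\<close> contribute the empty set.
\<close>

definition cond3 :: "('v, 'e) gbag ter \<Rightarrow> nat list \<Rightarrow> nat \<Rightarrow> bool" where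
  "cond3 T p s \<longleftrightarrow>
     (s \<in> bagB (sym_at T p) \<longrightarrow>
       (let Y = (if s \<in> bagb (sym_at T p) then bagy (sym_at T p) else {}) in
          bageta (sym_at T p) s = Y \<union> (\<Union>q\<in>children T p. bageta (sym_at T q) s) \<and>
          (\<forall>q\<in>children T p. Y \<inter> bageta (sym_at T q) s = {}) \<and>
          disjoint_family_on (\<lambda>q. bageta (sym_at T q) s) (children T p)))"

definition cond4 :: "('v, 'e) ugraph \<Rightarrow> ('v, 'e) gbag ter \<Rightarrow> nat list \<Rightarrow> nat \<Rightarrow> bool" where
  "cond4 G T p s \<longleftrightarrow>
     (s \<in> bagrho (sym_at T p) \<longrightarrow>
        bageta (sym_at T p) s = incident_edges G (bagnu (sym_at T p) s))"

definition cond5 :: "('v, 'e) gbag ter \<Rightarrow> nat list \<Rightarrow> nat \<Rightarrow> bool" where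
  "cond5 T p s \<longleftrightarrow>
     (\<forall>q\<in>children T p. s \<in> bagrho (sym_at T q) \<longleftrightarrow>
        s \<in> bagB (sym_at T q) \<and> s \<notin> bagB (sym_at T p))"

definition concrete_tree_decomposition ::
  "('v, 'e) ugraph \<Rightarrow> nat \<Rightarrow> ('v, 'e) gbag ter \<Rightarrow> bool" where
  "concrete_tree_decomposition G t T \<longleftrightarrow>
     T \<in> Ter (gbags G t) \<and>
     bagrho (sym_at T []) = bagB (sym_at T []) \<and>
     (\<forall>p\<in>Pos T. \<forall>s\<in>{1..t}.
        cond1 T p s \<and> cond2 G T p s \<and> cond3 T p s \<and> cond4 G T p s \<and> cond5 T p s)"

definition proj :: "('v, 'e) gbag ter \<Rightarrow> cbag ter" where
  "proj = map_ter cbag.truncate"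

end

theory Submission
  imports Defs
begin

text \<open>
  Given an isomorphism \<open>(f, g)\<close>, decorate the position \<open>p\<close> with \<open>\<nu>(s) = f v\<^bsub>s,P(p,s)\<^esub>\<close>, with
  \<open>y = {g e\<^sub>p}\<close>, and with \<open>\<eta>(s)\<close> the images of the edges at \<open>v\<^bsub>s,P(p,s)\<^esub>\<close> that are created at or
  below \<open>p\<close>. Conversely, the components \<open>\<nu>\<close> and \<open>y\<close> of a decomposition define a map from the graph
  of the term to \<open>G\<close>. Unfolding (C3) from the top of an \<open>s\<close>-maximal set, where (C5) and (C4) force
  \<open>\<eta>(s)\<close> to be the full set of incident edges, shows that this map is bijective on the edges around
  every vertex, that is, a covering. A covering of a connected graph is surjective on vertices (unless
  its source is empty), so equality of the vertex numbers makes it injective, and then bijective on edges.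
\<close>

section \<open>Connectivity through reachability\<close>

text \<open>\<open>is_path\<close> demands distinct vertices, so the induction erases loops: if the
  next vertex already lies on the path, the path is cut back to that occurrence instead of being
  extended.\<close>

lemma rtranclp_imp_path:
  assumes "(\<lambda>x y. x \<in> verts G \<and> y \<in> verts G \<and> adjacent G x y)\<^sup>*\<^sup>* u v" "u \<in> verts G"
  shows "\<exists>vs. is_path G vs \<and> hd vs = u \<and> last vs = v"
  using assms(1)
proof (induction rule: rtranclp_induct)
  case base
  show ?case using assms(2) by (intro exI[of _ "[u]"]) (simp add: is_path_def)
next
  case (step y z)
  then obtain vs where vs: "is_path G vs" "hd vs = u" "last vs = y" by blast
  show ?case
  proof (cases "z \<in> set vs")
    case True
    then obtain xs ys where xy: "vs = xs @ z # ys" by (meson split_list)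
    have "is_path G (xs @ [z])" "hd (xs @ [z]) = u"
      using vs unfolding xy by (auto simp: is_path_def successively_append_iff hd_append)
    then show ?thesis by (intro exI[of _ "xs @ [z]"]) simp
  next
    case False
    then have "is_path G (vs @ [z])" "hd (vs @ [z]) = u"
      using vs step.hyps by (auto simp: is_path_def successively_append_iff)
    then show ?thesis by (intro exI[of _ "vs @ [z]"]) simp
  qed
qed

lemma path_imp_rtranclp:
  assumes "vs \<noteq> []" "set vs \<subseteq> verts G" "successively (adjacent G) vs"
  shows "(\<lambda>x y. x \<in> verts G \<and> y \<in> verts G \<and> adjacent G x y)\<^sup>*\<^sup>* (hd vs) (last vs)"
  using assms
proof (induction vs rule: induct_list012)
  case (3 x y zs)
  then show ?case by (auto intro: converse_rtranclp_into_rtranclp)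
qed auto

text \<open>Reachability ignores repeated vertices, so later inductions can proceed arc by
  arc.\<close>

lemma connected_graph_iff_rtranclp:
  "connected_graph G \<longleftrightarrow> (\<forall>u\<in>verts G. \<forall>v\<in>verts G.
     (\<lambda>x y. x \<in> verts G \<and> y \<in> verts G \<and> adjacent G x y)\<^sup>*\<^sup>* u v)"
proof
  assume conn: "connected_graph G"
  show "\<forall>u\<in>verts G. \<forall>v\<in>verts G.
     (\<lambda>x y. x \<in> verts G \<and> y \<in> verts G \<and> adjacent G x y)\<^sup>*\<^sup>* u v"
  proof (intro ballI)
    fix u v assume "u \<in> verts G" "v \<in> verts G"
    with conn obtain vs where vs: "is_path G vs" "hd vs = u" "last vs = v"
      unfolding connected_graph_def by blast
    then show "(\<lambda>x y. x \<in> verts G \<and> y \<in> verts G \<and> adjacent G x y)\<^sup>*\<^sup>* u v"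
      using path_imp_rtranclp[of vs G] by (simp add: is_path_def)
  qed
next
  assume "\<forall>u\<in>verts G. \<forall>v\<in>verts G.
     (\<lambda>x y. x \<in> verts G \<and> y \<in> verts G \<and> adjacent G x y)\<^sup>*\<^sup>* u v"
  then show "connected_graph G"
    unfolding connected_graph_def by (intro ballI rtranclp_imp_path) auto
qed

section \<open>Components of sets of positions\<close>

text \<open>Orienting the arcs of the induced tree from parent to child makes uniqueness of parents
  available; the undirected arcs are the symmetric closure.\<close>

definition child_in :: "nat list set \<Rightarrow> nat list \<Rightarrow> nat list \<Rightarrow> bool" where
  "child_in A p q \<longleftrightarrow> p \<in> A \<and> q \<in> A \<and> (\<exists>j. q = p @ [j])"

definition component :: "nat list set \<Rightarrow> nat list \<Rightarrow> nat list set" where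
  "component A p = {q. equivclp (child_in A) p q}"

lemma adjacent_induced_tree: "adjacent (induced_tree P) x y \<longleftrightarrow> symclp (child_in P) x y"
proof -
  let ?A = "{{p, p @ [j]} |p j. p \<in> P \<and> p @ [j] \<in> P}"
  have "endpts (induced_tree P) a = (if a \<in> ?A then a else {})" for a
    by (auto simp: endpts_def induced_tree_def Let_def)
  then have "adjacent (induced_tree P) x y \<longleftrightarrow> {x, y} \<in> ?A"
    by (auto simp: adjacent_def induced_tree_def Let_def)
  also have "\<dots> \<longleftrightarrow> symclp (child_in P) x y"
    by (auto simp: symclp_def child_in_def doubleton_eq_iff)
  finally show ?thesis .
qed

lemma connected_pos_iff: "connected_pos P \<longleftrightarrow> (\<forall>p\<in>P. \<forall>q\<in>P. equivclp (child_in P) p q)"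
proof -
  have [simp]: "verts (induced_tree P) = P" by (simp add: induced_tree_def Let_def)
  have "(\<lambda>x y. x \<in> P \<and> y \<in> P \<and> symclp (child_in P) x y) = symclp (child_in P)"
    by (auto simp: fun_eq_iff symclp_def child_in_def)
  then show ?thesis
    by (simp add: connected_pos_def connected_graph_iff_rtranclp adjacent_induced_tree equivclp_def)
qed

lemma equivclp_child_in_mono:
  assumes "equivclp (child_in P) p q" "P \<subseteq> A"
  shows "equivclp (child_in A) p q"
  using assms(1)
proof (induction rule: equivclp_induct)
  case (step y z)
  then have "child_in A y z \<or> child_in A z y" using assms(2) by (auto simp: child_in_def)
  with step.IH show ?case by (meson equivclp_into_equivclp)
qed simp

lemma mem_component_self: "p \<in> component A p"
  by (simp add: component_def)

lemma component_subset:
  assumes "p \<in> A" shows "component A p \<subseteq> A"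
proof
  fix q assume "q \<in> component A p"
  then have "equivclp (child_in A) p q" by (simp add: component_def)
  then show "q \<in> A" using assms by (induction rule: equivclp_induct) (auto simp: child_in_def)
qed

lemma component_eq: "q \<in> component A p \<Longrightarrow> component A q = component A p"
  unfolding component_def by (auto intro: equivclp_trans equivclp_sym)

text \<open>A chain of arcs in \<open>A\<close> starting at \<open>p\<close> never leaves the
  component, so all its arcs are already arcs of the tree induced by the component.\<close>

lemma connected_pos_component: "connected_pos (component A p)"
proof -
  have "equivclp (child_in (component A p)) p q" if "equivclp (child_in A) p q" for q
    using that
  proof (induction rule: equivclp_induct)
    case (step y z)
    then have "equivclp (child_in A) p z" by (meson equivclp_into_equivclp)
    then have "child_in (component A p) y z \<or> child_in (component A p) z y"
      using step.hyps by (auto simp: child_in_def component_def)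
    with step.IH show ?case by (meson equivclp_into_equivclp)
  qed simp
  then show ?thesis
    unfolding connected_pos_iff
    by (metis component_def equivclp_sym equivclp_trans mem_Collect_eq)
qed

text \<open>Climbing from \<open>p\<close> as long as the parent stays in \<open>A\<close> must
  stop, because every move shortens the position.\<close>

lemma ex_root_in:
  assumes "p \<in> A"
  shows "\<exists>r\<in>A. (\<forall>q. \<not> child_in A q r) \<and> (child_in A)\<^sup>*\<^sup>* r p"
  using assms
proof (induction p rule: measure_induct_rule[where f = length])
  case (less p)
  show ?case
  proof (cases "\<exists>q. child_in A q p")
    case True
    then obtain q where q: "child_in A q p" by blast
    then have "length q < length p" "q \<in> A" by (auto simp: child_in_def)
    from less.IH[OF this] q show ?thesis by (meson rtranclp.rtrancl_into_rtrancl)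
  next
    case False
    then show ?thesis using less.prems by blast
  qed
qed

lemma rtranclp_child_in_mem_component: "(child_in A)\<^sup>*\<^sup>* p q \<Longrightarrow> q \<in> component A p"
  unfolding component_def
  by (induction rule: rtranclp_induct) (auto intro: equivclp_into_equivclp)

text \<open>Since parents are unique, the component of a position without parent in \<open>A\<close> is its
  down-set.\<close>

lemma component_root:
  assumes root: "\<forall>q. \<not> child_in A q r"
  shows "component A r = {q. (child_in A)\<^sup>*\<^sup>* r q}"
proof (intro set_eqI iffI CollectI)
  fix q assume "q \<in> component A r"
  then have "equivclp (child_in A) r q" by (simp add: component_def)
  then show "(child_in A)\<^sup>*\<^sup>* r q"
  proof (induction rule: equivclp_induct)
    case (step y z)
    from step.hyps(2) show ?case
    proof
      assume zy: "child_in A z y"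
      \<comment> \<open>An arc taken upwards only retraces the last downward arc: \<open>y\<close>
        has the parent \<open>z\<close> in \<open>A\<close> and so differs from \<open>r\<close>,
        and the parent of \<open>y\<close> is unique.\<close>
      from step.IH root zy obtain x where "(child_in A)\<^sup>*\<^sup>* r x" "child_in A x y"
        by (metis rtranclp.cases)
      moreover from this(2) zy have "x = z" by (auto simp: child_in_def)
      ultimately show ?case by simp
    qed (use step.IH in auto)
  qed simp
next
  fix q assume "q \<in> {q. (child_in A)\<^sup>*\<^sup>* r q}"
  then show "q \<in> component A r"
    using rtranclp_child_in_mem_component by blast
qed

lemma rtranclp_child_in_append: "(child_in A)\<^sup>*\<^sup>* p q \<Longrightarrow> \<exists>w. q = p @ w"
  by (induction rule: rtranclp_induct) (auto simp: child_in_def)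

lemma rtranclp_child_in_outside:
  assumes "(child_in A)\<^sup>*\<^sup>* p q" "p \<notin> A"
  shows "q = p"
  using assms by (metis child_in_def converse_rtranclpE)

lemma rtranclp_child_in_mem:
  "(child_in A)\<^sup>*\<^sup>* p q \<Longrightarrow> p \<in> A \<Longrightarrow> q \<in> A"
  by (induction rule: rtranclp_induct) (auto simp: child_in_def)

section \<open>Terms and positions\<close>

lemma Nil_in_Pos [simp]: "[] \<in> Pos T"
  by (cases T) auto

lemma finite_Pos: "finite (Pos T)"
  by (induction T) auto

lemma Pos_butlast: "p @ [j] \<in> Pos T \<Longrightarrow> p \<in> Pos T"
proof (induction T arbitrary: p)
  case (Unary a T) then show ?case by (cases p) auto
next
  case (Binary a T U) then show ?case by (cases p) auto
qed simp

lemma set_ter_eq: "set_ter T = sym_at T ` Pos T"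
proof (induction T)
  case (Unary a T)
  have "Pos (Unary a T) = insert [] ((#) 1 ` Pos T)" by auto
  then show ?case using Unary by (simp add: image_image)
next
  case (Binary a T U)
  have "Pos (Binary a T U) = insert [] ((#) 1 ` Pos T \<union> (#) 2 ` Pos U)" by auto
  then show ?case using Binary by (simp add: image_image image_Un)
qed simp

lemma Pos_map_ter [simp]: "Pos (map_ter h T) = Pos T"
  by (induction T) auto

lemma sym_at_map_ter: "p \<in> Pos T \<Longrightarrow> sym_at (map_ter h T) p = h (sym_at T p)"
  by (induction T arbitrary: p) auto

lemma in_Ter_iff: "T \<in> Ter \<Sigma> \<longleftrightarrow> (\<forall>p\<in>Pos T. sym_at T p \<in> \<Sigma>)"
  by (auto simp: Ter_def set_ter_eq)

text \<open>\<open>map_ter\<close> sees only the symbol, whereas a decoration depends on the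
  position. As \<open>F\<close> refers to positions of the whole term, it is composed with the step
  taken when a subterm is entered.\<close>

fun relabel :: "(nat list \<Rightarrow> 'b) \<Rightarrow> 'a ter \<Rightarrow> 'b ter" where
  "relabel F (Leaf a) = Leaf (F [])"
| "relabel F (Unary a T) = Unary (F []) (relabel (\<lambda>p. F (1 # p)) T)"
| "relabel F (Binary a T U) =
     Binary (F []) (relabel (\<lambda>p. F (1 # p)) T) (relabel (\<lambda>p. F (2 # p)) U)"

lemma Pos_relabel [simp]: "Pos (relabel F T) = Pos T"
  by (induction T arbitrary: F) auto

lemma sym_at_relabel [simp]: "p \<in> Pos T \<Longrightarrow> sym_at (relabel F T) p = F p"
  by (induction T arbitrary: F p) auto

lemma map_ter_relabel:
  "(\<And>p. p \<in> Pos T \<Longrightarrow> h (F p) = sym_at T p) \<Longrightarrow> map_ter h (relabel F T) = T"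
proof (induction T arbitrary: F)
  case (Unary a T)
  have "map_ter h (relabel (\<lambda>p. F (1 # p)) T) = T"
    by (rule Unary.IH) (use Unary.prems[of "1 # _"] in auto)
  then show ?case using Unary.prems[of "[]"] by simp
next
  case (Binary a T U)
  have "map_ter h (relabel (\<lambda>p. F (1 # p)) T) = T"
    by (rule Binary.IH(1)) (use Binary.prems[of "1 # _"] in auto)
  moreover have "map_ter h (relabel (\<lambda>p. F (2 # p)) U) = U"
    by (rule Binary.IH(2)) (use Binary.prems[of "2 # _"] in auto)
  ultimately show ?case using Binary.prems[of "[]"] by simp
qed simp

section \<open>The graph of a term\<close>

definition bag_positions :: "cbag ter \<Rightarrow> nat \<Rightarrow> nat list set" where
  "bag_positions T s = {p \<in> Pos T. s \<in> bagB (sym_at T p)}"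

lemma s_connected_iff: "s_connected T s P \<longleftrightarrow> P \<subseteq> bag_positions T s \<and> connected_pos P"
  by (auto simp: s_connected_def bag_positions_def)

lemma s_connected_subset_component:
  assumes "s_connected T s P" "p \<in> P"
  shows "P \<subseteq> component (bag_positions T s) p"
proof
  fix q assume "q \<in> P"
  then have "equivclp (child_in P) p q"
    using assms by (auto simp: s_connected_iff connected_pos_iff)
  then show "q \<in> component (bag_positions T s) p"
    using assms equivclp_child_in_mono by (auto simp: component_def s_connected_iff)
qed

lemma s_connected_component:
  "p \<in> bag_positions T s \<Longrightarrow> s_connected T s (component (bag_positions T s) p)"
  by (simp add: s_connected_iff component_subset connected_pos_component)

text \<open>A connected set that meets the component lies in the component of a common point, and
  these two components coincide.\<close>

lemma s_maximal_component:
  assumes "p \<in> bag_positions T s"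
  shows "s_maximal T s (component (bag_positions T s) p)"
  unfolding s_maximal_def
proof (intro conjI allI impI)
  show "component (bag_positions T s) p \<noteq> {}" using mem_component_self by blast
  show "s_connected T s (component (bag_positions T s) p)" using assms by (rule s_connected_component)
  fix P' assume P': "s_connected T s P'"
  show "component (bag_positions T s) p \<inter> P' = {} \<or> P' \<subseteq> component (bag_positions T s) p"
    using s_connected_subset_component[OF P'] component_eq by blast
qed

text \<open>The component of \<open>p\<close> is connected and meets \<open>P\<close>, so maximality
  places it inside \<open>P\<close>; connectedness of \<open>P\<close> gives the other inclusion.
  This uniqueness justifies the definite description in \<open>max_set\<close>.\<close>

lemma s_maximal_eq_component:
  assumes "s_maximal T s P" "p \<in> P"
  shows "p \<in> bag_positions T s" "P = component (bag_positions T s) p"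
proof -
  show p: "p \<in> bag_positions T s" using assms by (auto simp: s_maximal_def s_connected_iff)
  have "P \<inter> component (bag_positions T s) p \<noteq> {}" using assms(2) mem_component_self by blast
  then have "component (bag_positions T s) p \<subseteq> P"
    using assms(1) s_connected_component[OF p] unfolding s_maximal_def by blast
  moreover have "s_connected T s P" using assms(1) by (simp add: s_maximal_def)
  ultimately show "P = component (bag_positions T s) p"
    using s_connected_subset_component[OF _ assms(2)] by (intro equalityI)
qed

lemma max_set_eq_component:
  assumes "p \<in> bag_positions T s"
  shows "max_set T p s = component (bag_positions T s) p"
  unfolding max_set_def
  using s_maximal_component[OF assms] mem_component_self s_maximal_eq_component(2)
  by (intro the_equality) blast+

lemma verts_graph_of:
  "verts (graph_of T) = {(s, component (bag_positions T s) p) |s p. p \<in> bag_positions T s}"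
proof -
  have "\<exists>p. p \<in> bag_positions T s \<and> P = component (bag_positions T s) p" if "s_maximal T s P" for s P
    using that s_maximal_eq_component by (metis s_maximal_def ex_in_conv)
  then have "s_maximal T s P \<longleftrightarrow> (\<exists>p. p \<in> bag_positions T s \<and> P = component (bag_positions T s) p)"
    for s P using s_maximal_component by blast
  then show ?thesis by (auto simp: graph_of_def)
qed

text \<open>Each vertex is represented by the top position of its maximal set, the place where (C4)
  and (C5) take effect.\<close>

lemma vertex_root:
  assumes "v \<in> verts (graph_of T)"
  obtains s r where "v = (s, component (bag_positions T s) r)" "r \<in> bag_positions T s"
    "\<forall>q. \<not> child_in (bag_positions T s) q r"
proof -
  from assms obtain s p where sp: "v = (s, component (bag_positions T s) p)" "p \<in> bag_positions T s"
    by (auto simp: verts_graph_of)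
  from ex_root_in[OF sp(2)] obtain r where r: "r \<in> bag_positions T s"
    "\<forall>q. \<not> child_in (bag_positions T s) q r" "(child_in (bag_positions T s))\<^sup>*\<^sup>* r p" by blast
  from component_eq[OF rtranclp_child_in_mem_component[OF r(3)]] sp r that show ?thesis by simp
qed

section \<open>Edges of the graph of a term\<close>

lemma bagb_bag_positions:
  assumes "T \<in> Ter (cbags t)" "p \<in> Pos T" "s \<in> bagb (sym_at T p)"
  shows "p \<in> bag_positions T s"
  using assms by (auto simp: in_Ter_iff cbags_def bag_positions_def)

lemma edges_graph_of: "edges (graph_of T) = {p \<in> Pos T. bagb (sym_at T p) \<noteq> {}}"
  by (simp add: graph_of_def)

lemma endpts_graph_of:
  assumes "T \<in> Ter (cbags t)" "p \<in> Pos T"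
  shows "endpts (graph_of T) p = (\<lambda>s. (s, component (bag_positions T s) p)) ` bagb (sym_at T p)"
  using assms max_set_eq_component[OF bagb_bag_positions[OF assms]]
  by (auto simp: endpts_def graph_of_def)

lemma is_graph_graph_of:
  assumes T: "T \<in> Ter (cbags t)"
  shows "is_graph (graph_of T)"
  unfolding is_graph_def
proof (intro conjI ballI)
  have "verts (graph_of T) \<subseteq> {1..t} \<times> Pow (Pos T)"
  proof
    fix v assume "v \<in> verts (graph_of T)"
    then obtain s p where v: "v = (s, component (bag_positions T s) p)"
      and p: "p \<in> bag_positions T s" by (auto simp: verts_graph_of)
    have "s \<in> {1..t}" using T p unfolding in_Ter_iff cbags_def bag_positions_def by blast
    moreover have "component (bag_positions T s) p \<subseteq> Pos T"
      using component_subset[OF p] by (auto simp: bag_positions_def)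
    ultimately show "v \<in> {1..t} \<times> Pow (Pos T)" using v by simp
  qed
  then show "finite (verts (graph_of T))" by (rule finite_subset) (simp add: finite_Pos)
  show "finite (edges (graph_of T))" by (simp add: edges_graph_of finite_Pos)
  have "p \<in> Pos T \<and> s \<in> bagb (sym_at T p)" if "(p, (s, P)) \<in> inc (graph_of T)" for p s P
    using that by (auto simp: graph_of_def)
  moreover have "(s, P) \<in> verts (graph_of T)" if "(p, (s, P)) \<in> inc (graph_of T)" for p s P
  proof -
    from that have "p \<in> bag_positions T s" "P = max_set T p s"
      using bagb_bag_positions[OF T] by (auto simp: graph_of_def)
    then show ?thesis using max_set_eq_component by (auto simp: verts_graph_of)
  qed
  ultimately show "inc (graph_of T) \<subseteq> edges (graph_of T) \<times> verts (graph_of T)"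
    by (fastforce simp: edges_graph_of)
  fix p assume "p \<in> edges (graph_of T)"
  then have p: "p \<in> Pos T" "bagb (sym_at T p) \<noteq> {}" by (auto simp: edges_graph_of)
  \<comment> \<open>Different labels give different vertices, since the label is the first component
    of the pair; hence there are no loops.\<close>
  have "card (endpts (graph_of T) p) = card (bagb (sym_at T p))"
    unfolding endpts_graph_of[OF T p(1)] by (rule card_image) (auto simp: inj_on_def)
  then show "card (endpts (graph_of T) p) = 0 \<or> card (endpts (graph_of T) p) = 2"
    using p T by (auto simp: in_Ter_iff cbags_def)
qed

text \<open>An edge carrying the label \<open>s\<close> meets the vertex exactly if its position
  lies in the maximal set, and by \<open>component_root\<close> that set consists of the descendants
  of its top \<open>r\<close>.\<close>

lemma incident_edges_graph_of:
  assumes T: "T \<in> Ter (cbags t)" and r: "r \<in> bag_positions T s"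
    and root: "\<forall>q. \<not> child_in (bag_positions T s) q r"
  shows "incident_edges (graph_of T) (s, component (bag_positions T s) r) =
    {q. (child_in (bag_positions T s))\<^sup>*\<^sup>* r q \<and> s \<in> bagb (sym_at T q)}"
proof -
  let ?A = "bag_positions T s"
  have "q \<in> incident_edges (graph_of T) (s, component ?A r) \<longleftrightarrow>
      q \<in> Pos T \<and> s \<in> bagb (sym_at T q) \<and> component ?A r = component ?A q" for q
    using endpts_graph_of[OF T, of q]
    by (auto simp: incident_edges_def edges_graph_of endpts_def)
  moreover have "q \<in> Pos T \<and> component ?A r = component ?A q \<longleftrightarrow> (child_in ?A)\<^sup>*\<^sup>* r q"
    if "s \<in> bagb (sym_at T q)" for q
    using component_root[OF root] component_subset[OF r] component_eq[of q ?A r]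
      mem_component_self[of q ?A] by (auto simp: bag_positions_def)
  ultimately show ?thesis by blast
qed


text \<open>Splitting off the first arc of a descent gives the recursion (C3) on the side of
  positions, before any edges of \<open>G\<close> are involved.\<close>

lemma rtranclp_child_in_Un:
  assumes "p \<in> bag_positions T s"
  shows "{q. (child_in (bag_positions T s))\<^sup>*\<^sup>* p q \<and> s \<in> bagb (sym_at T q)} =
    (if s \<in> bagb (sym_at T p) then {p} else {}) \<union>
    (\<Union>c\<in>children T p \<inter> bag_positions T s.
       {q. (child_in (bag_positions T s))\<^sup>*\<^sup>* c q \<and> s \<in> bagb (sym_at T q)})"
proof -
  let ?A = "bag_positions T s"
  have "child_in ?A p c \<longleftrightarrow> c \<in> children T p \<inter> ?A" for c
    using assms by (auto simp: child_in_def children_def bag_positions_def)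
  then have "(child_in ?A)\<^sup>*\<^sup>* p q \<longleftrightarrow> q = p \<or> (\<exists>c\<in>children T p \<inter> ?A. (child_in ?A)\<^sup>*\<^sup>* c q)" for q
    by (metis converse_rtranclpE converse_rtranclp_into_rtranclp rtranclp.rtrancl_refl)
  then show ?thesis by auto
qed

text \<open>All descendants of a child share the last entry of that child. With
  \<open>not_rtranclp_child_in_parent\<close> this supplies the disjointness in (C3).\<close>

lemma rtranclp_child_in_siblings:
  assumes "(child_in A)\<^sup>*\<^sup>* c q" "(child_in A)\<^sup>*\<^sup>* c' q" "c \<in> children T p" "c' \<in> children T p"
  shows "c = c'"
  using assms rtranclp_child_in_append[of A c q] rtranclp_child_in_append[of A c' q]
  by (auto simp: children_def)

lemma not_rtranclp_child_in_parent: "c \<in> children T p \<Longrightarrow> \<not> (child_in A)\<^sup>*\<^sup>* c p"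
  using rtranclp_child_in_append[of A c p] by (auto simp: children_def)

section \<open>From an isomorphism to a decomposition\<close>

lemma isomorphism_endpts:
  assumes "isomorphism H G f g" "e \<in> edges H" "card (endpts H e) = 2"
  shows "endpts G (g e) = f ` endpts H e"
proof -
  from assms(3) obtain v v' where "endpts H e = {v, v'}" by (auto simp: card_2_iff)
  with assms show ?thesis by (auto simp: isomorphism_def)
qed

text \<open>\<open>isomorphism\<close> says nothing about the image of an edge without endpoints;
  excluding such edges in \<open>H\<close> leaves edges with two endpoints, and injectivity of
  \<open>f\<close> then reflects incidence back to \<open>H\<close>.\<close>

lemma isomorphism_incident_edges:
  assumes iso: "isomorphism H G f g" and H: "is_graph H" and v: "v \<in> verts H"
    and nonempty: "\<forall>e\<in>edges H. endpts H e \<noteq> {}"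
  shows "incident_edges G (f v) = g ` incident_edges H v"
proof -
  have ep: "endpts G (g e) = f ` endpts H e" if "e \<in> edges H" for e
  proof (rule isomorphism_endpts[OF iso that])
    have "endpts H e \<subseteq> verts H" using H that by (auto simp: is_graph_def endpts_def)
    then have "finite (endpts H e)" using H finite_subset by (auto simp: is_graph_def)
    then show "card (endpts H e) = 2" using H that nonempty by (fastforce simp: is_graph_def)
  qed
  have inj: "inj_on f (verts H)" and img: "g ` edges H = edges G"
    using iso by (auto simp: isomorphism_def bij_betw_def)
  have "(g e, f v) \<in> inc G \<longleftrightarrow> (e, v) \<in> inc H" if "e \<in> edges H" for e
  proof -
    have "(g e, f v) \<in> inc G \<longleftrightarrow> f v \<in> f ` endpts H e"
      using ep[OF that] by (auto simp: endpts_def)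
    also have "\<dots> \<longleftrightarrow> v \<in> endpts H e"
      using H by (intro inj_on_image_mem_iff[OF inj v]) (auto simp: is_graph_def endpts_def)
    finally show ?thesis by (simp add: endpts_def)
  qed
  then show ?thesis unfolding incident_edges_def img[symmetric] by blast
qed

text \<open>\<open>bagrho\<close> collects the labels for which \<open>p\<close> is the top of its
  maximal set, as (C5) dictates. \<open>bagnu\<close> is cut down to the bag explicitly;
  \<open>bageta\<close> becomes empty outside the bag by itself, because there \<open>p\<close>
  reaches only \<open>p\<close> and \<open>bagb\<close> is contained in \<open>bagB\<close>.\<close>

definition iso_bag ::
  "(nat \<times> nat list set \<Rightarrow> 'v) \<Rightarrow> (nat list \<Rightarrow> 'e) \<Rightarrow> cbag ter \<Rightarrow> nat list \<Rightarrow> ('v, 'e) gbag" where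
  "iso_bag f g T p =
    \<lparr>bagB = bagB (sym_at T p), bagb = bagb (sym_at T p),
     bagnu = (\<lambda>s\<in>bagB (sym_at T p). f (s, component (bag_positions T s) p)),
     bageta = (\<lambda>s. g ` {q. (child_in (bag_positions T s))\<^sup>*\<^sup>* p q \<and> s \<in> bagb (sym_at T q)}),
     bagy = (if bagb (sym_at T p) = {} then {} else {g p}),
     bagrho = {s. p \<in> bag_positions T s \<and> (\<forall>q. \<not> child_in (bag_positions T s) q p)}\<rparr>"

lemma max_deg_ge:
  assumes "is_graph G" "v \<in> verts G"
  shows "card (incident_edges G v) \<le> max_deg G"
  unfolding max_deg_def deg_def[symmetric]
  using assms by (intro Max_ge) (auto simp: is_graph_def)

lemma proj_relabel_iso_bag: "proj (relabel (iso_bag f g T) T) = T"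
  unfolding proj_def by (rule map_ter_relabel) (simp add: iso_bag_def cbag.truncate_def)

section \<open>The decoration satisfies (C1) to (C5)\<close>

context
  fixes G :: "('v, 'e) ugraph" and T :: "cbag ter" and t :: nat and f g
  assumes G: "is_graph G" and T: "T \<in> Ter (cbags t)" and iso: "isomorphism (graph_of T) G f g"
begin

lemma g_mem_edges: "p \<in> Pos T \<Longrightarrow> bagb (sym_at T p) \<noteq> {} \<Longrightarrow> g p \<in> edges G"
  using iso bij_betwE by (fastforce simp: isomorphism_def edges_graph_of)

lemma g_inj:
  assumes "g p = g q" "p \<in> Pos T" "q \<in> Pos T" "s \<in> bagb (sym_at T p)" "s \<in> bagb (sym_at T q)"
  shows "p = q"
proof -
  have "inj_on g (edges (graph_of T))" using iso by (simp add: isomorphism_def bij_betw_def)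
  then show ?thesis using assms by (auto simp: inj_on_def edges_graph_of)
qed

lemma graph_of_endpts_nonempty: "\<forall>e\<in>edges (graph_of T). endpts (graph_of T) e \<noteq> {}"
  using endpts_graph_of[OF T] by (auto simp: edges_graph_of)

text \<open>From the top of a maximal set the descent reaches the whole set, so no edge at the
  vertex is missing. This yields (C4).\<close>

lemma iso_bag_eta_root:
  assumes "p \<in> bag_positions T s" "\<forall>q. \<not> child_in (bag_positions T s) q p"
  shows "bageta (iso_bag f g T p) s = incident_edges G (bagnu (iso_bag f g T p) s)"
proof -
  have "(s, component (bag_positions T s) p) \<in> verts (graph_of T)"
    using assms by (auto simp: verts_graph_of)
  from isomorphism_incident_edges[OF iso is_graph_graph_of[OF T] this graph_of_endpts_nonempty]
  show ?thesis
    using assms(1) by (simp add: incident_edges_graph_of[OF T assms])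
      (simp add: iso_bag_def bag_positions_def)
qed

text \<open>Going down from the top \<open>r\<close> of the maximal set to \<open>p\<close> keeps
  \<open>bagnu\<close> and can only shrink \<open>bageta\<close>, so the claim reduces to the
  equality at \<open>r\<close>.\<close>

lemma iso_bag_eta_subset:
  assumes p: "p \<in> bag_positions T s"
  shows "bageta (iso_bag f g T p) s \<subseteq> incident_edges G (bagnu (iso_bag f g T p) s)"
proof -
  from ex_root_in[OF p] obtain r where r: "r \<in> bag_positions T s"
    "\<forall>q. \<not> child_in (bag_positions T s) q r" "(child_in (bag_positions T s))\<^sup>*\<^sup>* r p" by blast
  have "component (bag_positions T s) p = component (bag_positions T s) r"
    by (intro component_eq rtranclp_child_in_mem_component r)
  then have "bagnu (iso_bag f g T p) s = bagnu (iso_bag f g T r) s"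
    using p r by (simp add: iso_bag_def bag_positions_def)
  moreover have "bageta (iso_bag f g T p) s \<subseteq> bageta (iso_bag f g T r) s"
    using r(3) by (auto simp: iso_bag_def)
  ultimately show ?thesis using iso_bag_eta_root[OF r(1,2)] by simp
qed

lemma iso_bag_in_gbags:
  assumes p: "p \<in> Pos T"
  shows "iso_bag f g T p \<in> gbags G t"
proof -
  have cb: "sym_at T p \<in> cbags t" using T p by (simp add: in_Ter_iff)
  have mem: "(s, component (bag_positions T s) p) \<in> verts (graph_of T)"
    if "s \<in> bagB (sym_at T p)" for s
    using that p by (auto simp: verts_graph_of bag_positions_def)
  have f: "inj_on f (verts (graph_of T))" "f ` verts (graph_of T) = verts G"
    using iso by (auto simp: isomorphism_def bij_betw_def)
  have nu: "bagnu (iso_bag f g T p) s \<in> verts G" if "s \<in> bagB (sym_at T p)" for s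
    using mem[OF that] f(2) that by (auto simp: iso_bag_def)
  have "bagnu (iso_bag f g T p) \<in> bagB (sym_at T p) \<rightarrow>\<^sub>E verts G"
    using nu by (intro PiE_I) (auto simp: iso_bag_def)
  moreover have "inj_on (bagnu (iso_bag f g T p)) (bagB (sym_at T p))"
    using f(1) mem by (fastforce simp: inj_on_def iso_bag_def)
  moreover have "bageta (iso_bag f g T p) s \<subseteq> incident_edges G (bagnu (iso_bag f g T p) s)
      \<and> card (bageta (iso_bag f g T p) s) \<le> max_deg G" if s: "s \<in> bagB (sym_at T p)" for s
  proof
    show sub: "bageta (iso_bag f g T p) s \<subseteq> incident_edges G (bagnu (iso_bag f g T p) s)"
      using s p by (intro iso_bag_eta_subset) (simp add: bag_positions_def)
    have "finite (incident_edges G (bagnu (iso_bag f g T p) s))"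
      using G by (auto simp: incident_edges_def is_graph_def)
    from card_mono[OF this sub] max_deg_ge[OF G nu[OF s]]
    show "card (bageta (iso_bag f g T p) s) \<le> max_deg G" by simp
  qed
  moreover have "bageta (iso_bag f g T p) s = {}" if "s \<notin> bagB (sym_at T p)" for s
  proof -
    have "p \<notin> bag_positions T s" using that by (simp add: bag_positions_def)
    then have "s \<notin> bagb (sym_at T q)" if "(child_in (bag_positions T s))\<^sup>*\<^sup>* p q" for q
      using rtranclp_child_in_outside[OF that] bagb_bag_positions[OF T p] by auto
    then show ?thesis by (auto simp: iso_bag_def)
  qed
  moreover have "bagy (iso_bag f g T p) \<subseteq> bageta (iso_bag f g T p) s" if "s \<in> bagb (sym_at T p)" for s
    using that by (auto simp: iso_bag_def)
  moreover have "bagy (iso_bag f g T p) \<subseteq> edges G" "card (bagy (iso_bag f g T p)) \<le> 1"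
    using g_mem_edges[OF p] by (auto simp: iso_bag_def)
  moreover have "bagrho (iso_bag f g T p) \<subseteq> bagB (sym_at T p)"
    by (auto simp: iso_bag_def bag_positions_def)
  moreover have "cbag.truncate (iso_bag f g T p) = sym_at T p"
    "bagB (iso_bag f g T p) = bagB (sym_at T p)" "bagb (iso_bag f g T p) = bagb (sym_at T p)"
    by (simp_all add: iso_bag_def cbag.truncate_def)
  ultimately show ?thesis using cb unfolding gbags_def mem_Collect_eq by simp
qed

lemma concrete_tree_decomposition_relabel:
  "concrete_tree_decomposition G t (relabel (iso_bag f g T) T)"
  unfolding concrete_tree_decomposition_def
proof (intro conjI ballI)
  let ?T = "relabel (iso_bag f g T) T"
  show "?T \<in> Ter (gbags G t)" using iso_bag_in_gbags by (simp add: in_Ter_iff)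
  \<comment> \<open>The empty position has no parent, so it is a top for every label of its
    bag.\<close>
  show "bagrho (sym_at ?T []) = bagB (sym_at ?T [])"
    by (auto simp: iso_bag_def bag_positions_def child_in_def)
  fix p s assume "p \<in> Pos ?T" and "s \<in> {1..t}"
  then have p: "p \<in> Pos T" by simp
  let ?A = "bag_positions T s"
  have ch: "children ?T p = children T p" by (simp add: children_def)
  have chP: "c \<in> Pos T" if "c \<in> children T p" for c using that by (simp add: children_def)
  have chA: "child_in ?A p c" if "c \<in> children T p" "p \<in> ?A" "c \<in> ?A" for c
    using that by (auto simp: children_def child_in_def)
  show "cond1 ?T p s"
    unfolding cond1_def ch
  proof (intro ballI impI)
    fix c assume c: "c \<in> children T p" and s: "s \<in> bagB (sym_at ?T p) \<inter> bagB (sym_at ?T c)"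
    then have A: "p \<in> ?A" "c \<in> ?A" using p chP[OF c] by (auto simp: iso_bag_def bag_positions_def)
    then have "component ?A c = component ?A p"
      using chA[OF c] by (intro component_eq rtranclp_child_in_mem_component) auto
    then show "bagnu (sym_at ?T p) s = bagnu (sym_at ?T c) s"
      using A p chP[OF c] by (simp add: iso_bag_def bag_positions_def)
  qed
  show "cond2 G ?T p s"
    unfolding cond2_def
  proof (intro allI impI)
    fix s' assume "bagb (sym_at ?T p) = {s, s'}"
    then have b: "bagb (sym_at T p) = {s, s'}" using p by (simp add: iso_bag_def)
    have B: "s \<in> bagB (sym_at T p)" "s' \<in> bagB (sym_at T p)" and c2: "card (bagb (sym_at T p)) = 2"
      using T p b by (auto simp: in_Ter_iff cbags_def)
    have e: "p \<in> edges (graph_of T)" using p b by (simp add: edges_graph_of)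
    have "card (endpts (graph_of T) p) = 2"
      unfolding endpts_graph_of[OF T p] c2[symmetric] by (rule card_image) (auto simp: inj_on_def)
    from isomorphism_endpts[OF iso e this]
    have "endpts G (g p) = {bagnu (iso_bag f g T p) s, bagnu (iso_bag f g T p) s'}"
      using B by (simp add: endpts_graph_of[OF T p] b iso_bag_def)
    moreover have "bagy (iso_bag f g T p) = {g p}" using b by (simp add: iso_bag_def)
    moreover have "g p \<in> edges G" using g_mem_edges[OF p] b by simp
    ultimately show "\<exists>e\<in>edges G. bagy (sym_at ?T p) = {e} \<and>
        endpts G e = {bagnu (sym_at ?T p) s, bagnu (sym_at ?T p) s'}"
      using p by auto
  qed
  show "cond3 ?T p s"
  proof (cases "s \<in> bagB (sym_at T p)")
    case False
    then show ?thesis using p by (simp add: cond3_def iso_bag_def)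
  next
    case True
    define D where "D c = {q. (child_in ?A)\<^sup>*\<^sup>* c q \<and> s \<in> bagb (sym_at T q)}" for c
    have pA: "p \<in> ?A" using True p by (simp add: bag_positions_def)
    \<comment> \<open>A child without \<open>s\<close> in its bag contributes no edge, so the union
      over all children in \<open>cond3\<close> agrees with the one over children in
      \<open>?A\<close>.\<close>
    have Dempty: "D c = {}" if "c \<in> children T p" "c \<notin> ?A" for c
      using rtranclp_child_in_outside[of ?A c] that bagb_bag_positions[OF T chP]
      by (auto simp: D_def)
    have DPos: "q \<in> Pos T \<and> s \<in> bagb (sym_at T q) \<and> (child_in ?A)\<^sup>*\<^sup>* c q"
      if "c \<in> children T p" "q \<in> D c" for c q
      using that rtranclp_child_in_mem[of ?A c q] Dempty[of c]
      by (cases "c \<in> ?A") (auto simp: D_def bag_positions_def)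
    have eta: "bageta (sym_at ?T c) s = g ` D c" if "c \<in> Pos T" for c
      using that by (simp add: iso_bag_def D_def)
    have Y: "(if s \<in> bagb (sym_at ?T p) then bagy (sym_at ?T p) else {}) =
        (if s \<in> bagb (sym_at T p) then {g p} else {})"
      using p by (auto simp: iso_bag_def)
    have "D p = (if s \<in> bagb (sym_at T p) then {p} else {}) \<union> (\<Union>c\<in>children T p \<inter> ?A. D c)"
      unfolding D_def by (rule rtranclp_child_in_Un[OF pA])
    also have "(\<Union>c\<in>children T p \<inter> ?A. D c) = (\<Union>c\<in>children T p. D c)"
      using Dempty by blast
    finally have "g ` D p = (if s \<in> bagb (sym_at T p) then {g p} else {}) \<union>
        (\<Union>c\<in>children T p. g ` D c)" by auto
    \<comment> \<open>Injectivity of \<open>g\<close> reduces both disjointness claims of (C3) to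
      positions: a child never descends to its parent, and siblings have no common
      descendant.\<close>
    moreover have "g p \<notin> g ` D c" if "c \<in> children T p" "s \<in> bagb (sym_at T p)" for c
      using DPos[OF that(1)] g_inj[OF _ p _ that(2)] not_rtranclp_child_in_parent[OF that(1)]
      by blast
    moreover have "disjoint_family_on (\<lambda>c. g ` D c) (children T p)"
      unfolding disjoint_family_on_def
    proof (intro ballI impI)
      fix c c' assume c: "c \<in> children T p" "c' \<in> children T p" "c \<noteq> c'"
      have "g q \<noteq> g q'" if "q \<in> D c" "q' \<in> D c'" for q q'
        using DPos[OF c(1) that(1)] DPos[OF c(2) that(2)] g_inj[of q q' s]
          rtranclp_child_in_siblings[OF _ _ c(1,2)] c(3) by blast
      then show "g ` D c \<inter> g ` D c' = {}" by blast
    qed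
    ultimately show ?thesis
      unfolding cond3_def Let_def Y ch
      using eta p chP by (auto simp: disjoint_family_on_def)
  qed
  show "cond4 G ?T p s"
    using iso_bag_eta_root[of p s] p by (auto simp: cond4_def) (auto simp: iso_bag_def)
  show "cond5 ?T p s"
    unfolding cond5_def ch
  proof
    fix c assume c: "c \<in> children T p"
    \<comment> \<open>Only \<open>p\<close> can be the parent of \<open>c\<close>, so
      \<open>c\<close> is a top for \<open>s\<close> exactly if its bag contains \<open>s\<close>
      and that of \<open>p\<close> does not.\<close>
    then obtain j where j: "c = p @ [j]" by (auto simp: children_def)
    show "s \<in> bagrho (sym_at ?T c) \<longleftrightarrow> s \<in> bagB (sym_at ?T c) \<and> s \<notin> bagB (sym_at ?T p)"
      using p chP[OF c] by (auto simp: iso_bag_def child_in_def bag_positions_def j)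
  qed
qed

end

section \<open>From a decomposition to an isomorphism\<close>

text \<open>Kept free of terms and bags: \<open>bij\<close> lets each edge at \<open>f v\<close> be
  lifted to an edge at \<open>v\<close>, and everything else is lifting and counting.\<close>

lemma covering_imp_isomorphism:
  assumes H: "is_graph H" and G: "is_graph G" "connected_graph G"
    and nonempty: "\<forall>e\<in>edges G. endpts G e \<noteq> {}"
    and card: "card (verts H) = card (verts G)"
    and f: "\<And>v. v \<in> verts H \<Longrightarrow> f v \<in> verts G"
    and g: "\<And>e. e \<in> edges H \<Longrightarrow> g e \<in> edges G"
    and ends: "\<And>e. e \<in> edges H \<Longrightarrow> endpts G (g e) = f ` endpts H e"
    and bij: "\<And>v. v \<in> verts H \<Longrightarrow> bij_betw g (incident_edges H v) (incident_edges G (f v))"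
  shows "isomorphism H G f g"
proof -
  have fin: "finite (verts H)" "finite (verts G)" using H G by (auto simp: is_graph_def)
  have endsH: "endpts H e \<subseteq> verts H" for e using H by (auto simp: is_graph_def endpts_def)
  have lift: "\<exists>e'\<in>incident_edges H v. e = g e'" if "v \<in> verts H" "e \<in> incident_edges G (f v)" for v e
    using bij[OF that(1)] that(2) by (auto simp: bij_betw_def)
  have surj: "f ` verts H = verts G"
  proof (cases "verts H = {}")
    case True
    \<comment> \<open>Without vertices in \<open>H\<close> there is nothing to lift from; here the
      equality of cardinalities leaves \<open>G\<close> without vertices too.\<close>
    then show ?thesis using card fin by simp
  next
    case False
    then obtain v0 where v0: "v0 \<in> verts H" by blast
    have "w \<in> f ` verts H" if "w \<in> verts G" for w
    proof -
      have "(\<lambda>x y. x \<in> verts G \<and> y \<in> verts G \<and> adjacent G x y)\<^sup>*\<^sup>* (f v0) w"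
        using G(2) f[OF v0] that unfolding connected_graph_iff_rtranclp by blast
      then show ?thesis
      proof (induction rule: rtranclp_induct)
        case base
        then show ?case using v0 by blast
      next
        case (step y z)
        then obtain v e where v: "v \<in> verts H" "y = f v" and e: "e \<in> edges G" "endpts G e = {y, z}"
          by (auto simp: adjacent_def)
        \<comment> \<open>The image of \<open>f\<close> is closed under adjacency: the edge from
          \<open>f v\<close> to \<open>z\<close> lifts to an edge at \<open>v\<close>, one of whose
          endpoints maps to \<open>z\<close>.\<close>
        have "e \<in> incident_edges G (f v)" using e v by (auto simp: incident_edges_def endpts_def)
        with lift v obtain e' where e': "e' \<in> edges H" "e = g e'" by (auto simp: incident_edges_def)
        have "z \<in> f ` endpts H e'" using e ends[OF e'(1)] e'(2) by auto
        then show ?case using endsH by blast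
      qed
    qed
    then show ?thesis using f by blast
  qed
  then have inj: "inj_on f (verts H)" using card fin by (simp add: eq_card_imp_inj_on)
  have "e \<in> g ` edges H" if e: "e \<in> edges G" for e
  proof -
    from nonempty e obtain w where w: "(e, w) \<in> inc G" by (auto simp: endpts_def)
    then have "w \<in> verts G" using G by (auto simp: is_graph_def)
    then obtain v where "v \<in> verts H" "w = f v" using surj by blast
    moreover from this w e have "e \<in> incident_edges G (f v)" by (simp add: incident_edges_def)
    ultimately show ?thesis using lift by (fastforce simp: incident_edges_def)
  qed
  then have surj_g: "g ` edges H = edges G" using g by blast
  have "inj_on g (edges H)"
  proof (rule inj_onI)
    fix e e' assume e: "e \<in> edges H" "e' \<in> edges H" "g e = g e'"
    have "endpts G (g e) \<noteq> {}" using nonempty g[OF e(1)] by blast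
    then obtain v where v: "v \<in> endpts H e" using ends[OF e(1)] by auto
    then have "f v \<in> f ` endpts H e'" using ends[OF e(1)] ends[OF e(2)] e(3) by auto
    \<comment> \<open>Two edges with the same image share an endpoint, because \<open>f\<close> is
      injective; at that vertex \<open>g\<close> is injective by \<open>bij\<close>.\<close>
    then have "v \<in> endpts H e'" using inj_on_image_mem_iff[OF inj _ endsH] v endsH by blast
    then have "e \<in> incident_edges H v" "e' \<in> incident_edges H v"
      using v e by (auto simp: incident_edges_def endpts_def)
    moreover have "inj_on g (incident_edges H v)"
      using bij v endsH by (auto simp: bij_betw_def)
    ultimately show "e = e'" using e(3) by (auto dest: inj_onD)
  qed
  then show ?thesis
    unfolding isomorphism_def using inj surj surj_g ends by (auto simp: bij_betw_def)
qed

section \<open>The covering defined by a decomposition\<close>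

context
  fixes G :: "('v, 'e) ugraph" and T :: "cbag ter" and t :: nat and T' :: "('v, 'e) gbag ter"
  assumes T: "T \<in> Ter (cbags t)" and dec: "concrete_tree_decomposition G t T'"
    and proj: "T = proj T'"
begin

lemma Pos_decomposition: "Pos T' = Pos T"
  by (simp add: proj proj_def)

lemma bag_decomposition:
  assumes "p \<in> Pos T"
  shows "bagB (sym_at T' p) = bagB (sym_at T p)" "bagb (sym_at T' p) = bagb (sym_at T p)"
  using assms unfolding proj proj_def by (simp_all add: sym_at_map_ter cbag.truncate_def)

lemma children_decomposition: "children T' p = children T p"
  by (simp add: children_def Pos_decomposition)

lemma gbag_decomposition: "p \<in> Pos T \<Longrightarrow> sym_at T' p \<in> gbags G t"
  using dec by (simp add: concrete_tree_decomposition_def in_Ter_iff Pos_decomposition)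

lemma bag_positions_le: "p \<in> bag_positions T s \<Longrightarrow> p \<in> Pos T \<and> s \<in> {1..t}"
  using T unfolding bag_positions_def in_Ter_iff cbags_def by blast

lemma conds_decomposition:
  assumes "p \<in> bag_positions T s"
  shows "cond1 T' p s" "cond2 G T' p s" "cond3 T' p s" "cond4 G T' p s"
  using dec bag_positions_le[OF assms] Pos_decomposition
  by (auto simp: concrete_tree_decomposition_def)

text \<open>Any position of the maximal set may be chosen, since (C1) makes the value constant along
  the set; \<open>nu_component\<close> proves this.\<close>

definition node_map :: "nat \<times> nat list set \<Rightarrow> 'v" where
  "node_map v = bagnu (sym_at T' (SOME p. p \<in> snd v)) (fst v)"

text \<open>The value is meaningful where \<open>bagb\<close> is nonempty, since (C2) makes
  \<open>bagy\<close> a singleton there.\<close>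

definition edge_map :: "nat list \<Rightarrow> 'e" where
  "edge_map p = the_elem (bagy (sym_at T' p))"

lemma nu_child:
  assumes "child_in (bag_positions T s) p q"
  shows "bagnu (sym_at T' p) s = bagnu (sym_at T' q) s"
proof -
  have pq: "p \<in> bag_positions T s" "q \<in> bag_positions T s" "q \<in> children T p"
    using assms by (auto simp: child_in_def children_def bag_positions_def)
  then show ?thesis
    using conds_decomposition(1)[OF pq(1)] bag_decomposition
    by (auto simp: cond1_def children_decomposition bag_positions_def)
qed

lemma nu_component:
  assumes "q \<in> component (bag_positions T s) p"
  shows "bagnu (sym_at T' q) s = bagnu (sym_at T' p) s"
proof -
  from assms have "equivclp (child_in (bag_positions T s)) p q" by (simp add: component_def)
  then show ?thesis
    by (induction rule: equivclp_induct) (auto dest: nu_child)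
qed

lemma node_map_component:
  "node_map (s, component (bag_positions T s) p) = bagnu (sym_at T' p) s"
  unfolding node_map_def fst_conv snd_conv
  by (rule nu_component) (rule someI, rule mem_component_self)

lemma edge_map_decomposition:
  assumes p: "p \<in> edges (graph_of T)"
  shows "bagy (sym_at T' p) = {edge_map p}" "edge_map p \<in> edges G"
    "endpts G (edge_map p) = node_map ` endpts (graph_of T) p"
proof -
  have pP: "p \<in> Pos T" "bagb (sym_at T p) \<noteq> {}" using p by (auto simp: edges_graph_of)
  then have "card (bagb (sym_at T p)) = 2" using T by (auto simp: in_Ter_iff cbags_def)
  then obtain s s' where b: "bagb (sym_at T p) = {s, s'}" by (auto simp: card_2_iff)
  have "p \<in> bag_positions T s" using bagb_bag_positions[OF T pP(1)] b by simp
  from conds_decomposition(2)[OF this] obtain e where e: "e \<in> edges G" "bagy (sym_at T' p) = {e}"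
    "endpts G e = {bagnu (sym_at T' p) s, bagnu (sym_at T' p) s'}"
    using b bag_decomposition[OF pP(1)] by (auto simp: cond2_def)
  then have em: "edge_map p = e" by (simp add: edge_map_def)
  show "bagy (sym_at T' p) = {edge_map p}" "edge_map p \<in> edges G" using e em by simp_all
  show "endpts G (edge_map p) = node_map ` endpts (graph_of T) p"
    using e em by (simp add: endpts_graph_of[OF T pP(1)] b node_map_component)
qed

text \<open>(C3) and \<open>rtranclp_child_in_Un\<close> are the same recursion, for
  \<open>bageta\<close> and for \<open>D\<close>. The bijections at the children therefore glue
  together, and (C3) provides the disjoint images that gluing needs.\<close>

lemma eta_decomposition:
  assumes "p \<in> bag_positions T s"
  defines "D \<equiv> \<lambda>p. {q. (child_in (bag_positions T s))\<^sup>*\<^sup>* p q \<and> s \<in> bagb (sym_at T q)}"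
  shows "bij_betw edge_map (D p) (bageta (sym_at T' p) s)"
proof -
  let ?A = "bag_positions T s"
  \<comment> \<open>A bound on the lengths of positions, so that the induction can run from the
    leaves upwards; as children also obey it, the truncated difference strictly decreases.\<close>
  let ?N = "Max (length ` Pos T)"
  show ?thesis using assms(1)
  proof (induction p rule: measure_induct_rule[where f = "\<lambda>p. ?N - length p"])
    case (less p)
    let ?C = "children T p \<inter> ?A"
    have p: "p \<in> Pos T" using less.prems by (simp add: bag_positions_def)
    have IH: "bij_betw edge_map (D c) (bageta (sym_at T' c) s)" if c: "c \<in> ?C" for c
    proof (rule less.IH)
      have "length c = Suc (length p)" "c \<in> Pos T" using c by (auto simp: children_def)
      moreover have "length c \<le> ?N" using \<open>c \<in> Pos T\<close> by (simp add: finite_Pos)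
      ultimately show "?N - length c < ?N - length p" by simp
      show "c \<in> ?A" using c by simp
    qed
    let ?Y = "if s \<in> bagb (sym_at T p) then {edge_map p} else {}"
    have Y: "(if s \<in> bagb (sym_at T' p) then bagy (sym_at T' p) else {}) = ?Y"
      using p edge_map_decomposition(1)[of p] bag_decomposition[OF p] by (auto simp: edges_graph_of)
    \<comment> \<open>The empty default of \<open>bageta\<close> outside the bag lets the union in
      (C3) be restricted to the children whose bags contain \<open>s\<close>.\<close>
    have out: "bageta (sym_at T' c) s = {}" if "c \<in> children T p" "c \<notin> ?A" for c
      using gbag_decomposition[of c] bag_decomposition[of c] that
      by (auto simp: gbags_def children_def bag_positions_def)
    have c3: "bageta (sym_at T' p) s = ?Y \<union> (\<Union>c\<in>children T p. bageta (sym_at T' c) s)"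
      "\<forall>c\<in>children T p. ?Y \<inter> bageta (sym_at T' c) s = {}"
      "disjoint_family_on (\<lambda>c. bageta (sym_at T' c) s) (children T p)"
      using conds_decomposition(3)[OF less.prems] less.prems bag_decomposition[OF p]
      unfolding cond3_def Let_def Y children_decomposition by (simp_all add: bag_positions_def)
    have "(\<Union>c\<in>children T p. bageta (sym_at T' c) s) = (\<Union>c\<in>?C. bageta (sym_at T' c) s)"
      using out by blast
    with c3(1) have eta: "bageta (sym_at T' p) s = ?Y \<union> (\<Union>c\<in>?C. bageta (sym_at T' c) s)" by simp
    let ?X = "if s \<in> bagb (sym_at T p) then {p} else {}"
    have D: "D p = ?X \<union> (\<Union>c\<in>?C. D c)"
      unfolding D_def by (rule rtranclp_child_in_Un[OF less.prems])
    have "bij_betw edge_map (\<Union>c\<in>?C. D c) (\<Union>c\<in>?C. bageta (sym_at T' c) s)"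
    proof (rule bij_betw_UNION_disjoint)
      show "disjoint_family_on (\<lambda>c. bageta (sym_at T' c) s) ?C"
        using c3(3) by (auto simp: disjoint_family_on_def)
    qed (rule IH)
    moreover have "bij_betw edge_map ?X ?Y" by (simp add: bij_betw_def)
    moreover have "?Y \<inter> (\<Union>c\<in>?C. bageta (sym_at T' c) s) = {}" using c3(2) by blast
    ultimately show ?case unfolding D eta by (intro bij_betw_combine)
  qed
qed

lemma eta_root:
  \<comment> \<open>At a top position either the term begins or the bag of the parent lacks
    \<open>s\<close>; in both cases (C5) puts \<open>s\<close> into \<open>bagrho\<close>, and (C4)
    applies.\<close>
  assumes r: "r \<in> bag_positions T s" and root: "\<forall>q. \<not> child_in (bag_positions T s) q r"
  shows "bageta (sym_at T' r) s = incident_edges G (bagnu (sym_at T' r) s)"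
proof -
  have rP: "r \<in> Pos T" "s \<in> bagB (sym_at T r)" using r by (auto simp: bag_positions_def)
  have "s \<in> bagrho (sym_at T' r)"
  proof (cases r rule: rev_cases)
    case Nil
    then show ?thesis using dec rP bag_decomposition[OF rP(1)]
      by (simp add: concrete_tree_decomposition_def)
  next
    case (snoc p j)
    then have p: "p \<in> Pos T" "r \<in> children T p" using rP Pos_butlast by (auto simp: children_def)
    have "p \<notin> bag_positions T s" using root r snoc by (auto simp: child_in_def)
    then have "s \<notin> bagB (sym_at T p)" using p by (simp add: bag_positions_def)
    moreover have "cond5 T' p s"
      using dec bag_positions_le[OF r] p Pos_decomposition by (auto simp: concrete_tree_decomposition_def)
    ultimately show ?thesis
      using p rP bag_decomposition by (auto simp: cond5_def children_decomposition)
  qed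
  then show ?thesis using conds_decomposition(4)[OF r] by (simp add: cond4_def)
qed

lemma bij_betw_edge_map_incident_edges:
  assumes "v \<in> verts (graph_of T)"
  shows "bij_betw edge_map (incident_edges (graph_of T) v) (incident_edges G (node_map v))"
proof -
  from assms obtain s r where v: "v = (s, component (bag_positions T s) r)"
    and r: "r \<in> bag_positions T s" "\<forall>q. \<not> child_in (bag_positions T s) q r"
    by (rule vertex_root)
  show ?thesis
    using eta_decomposition[OF r(1)] eta_root[OF r]
    unfolding v incident_edges_graph_of[OF T r] node_map_component by simp
qed

lemma node_map_in_verts:
  assumes "v \<in> verts (graph_of T)"
  shows "node_map v \<in> verts G"
proof -
  from assms obtain s p where v: "v = (s, component (bag_positions T s) p)"
    and p: "p \<in> bag_positions T s" by (auto simp: verts_graph_of)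
  then have "s \<in> bagB (sym_at T' p)" "bagnu (sym_at T' p) \<in> bagB (sym_at T' p) \<rightarrow>\<^sub>E verts G"
    using gbag_decomposition[of p] bag_decomposition[of p] by (auto simp: gbags_def bag_positions_def)
  then show ?thesis unfolding v node_map_component by (auto simp: PiE_mem)
qed

lemma isomorphism_decomposition:
  assumes "is_graph G" "connected_graph G" "\<forall>e\<in>edges G. endpts G e \<noteq> {}"
    and "card (verts (graph_of T)) = card (verts G)"
  shows "isomorphism (graph_of T) G node_map edge_map"
  using is_graph_graph_of[OF T] assms
  by (rule covering_imp_isomorphism)
    (simp_all add: node_map_in_verts edge_map_decomposition bij_betw_edge_map_incident_edges)

end

text \<open>Edges of \<open>G\<close> without endpoints are excluded because a decomposition cannot
  see them: they lie in no \<open>bageta\<close>, while all edges of \<open>graph_of T\<close> have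
  two endpoints.\<close>

theorem theorem5p2:
  fixes G :: "('v, 'e) ugraph" and t :: nat and T :: "cbag ter"
  assumes "is_graph G"
    and "connected_graph G"
    and "\<forall>e\<in>edges G. endpts G e \<noteq> {}"
    and "T \<in> Ter (cbags t)"
  shows "isomorphic (graph_of T) G \<longleftrightarrow>
    card (verts (graph_of T)) = card (verts G) \<and>
    (\<exists>T'. T' \<in> Ter (gbags G t) \<and> concrete_tree_decomposition G t T' \<and> T = proj T')"
proof
  assume "isomorphic (graph_of T) G"
  then obtain f g where iso: "isomorphism (graph_of T) G f g" by (auto simp: isomorphic_def)
  let ?T = "relabel (iso_bag f g T) T"
  have "concrete_tree_decomposition G t ?T"
    by (rule concrete_tree_decomposition_relabel[OF assms(1,4) iso])
  moreover have "T = proj ?T" by (rule proj_relabel_iso_bag[symmetric])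
  moreover have "card (verts (graph_of T)) = card (verts G)"
    using iso by (auto simp: isomorphism_def intro: bij_betw_same_card)
  ultimately show "card (verts (graph_of T)) = card (verts G) \<and>
    (\<exists>T'. T' \<in> Ter (gbags G t) \<and> concrete_tree_decomposition G t T' \<and> T = proj T')"
    by (auto simp: concrete_tree_decomposition_def)
next
  assume "card (verts (graph_of T)) = card (verts G) \<and>
    (\<exists>T'. T' \<in> Ter (gbags G t) \<and> concrete_tree_decomposition G t T' \<and> T = proj T')"
  then show "isomorphic (graph_of T) G"
    using isomorphism_decomposition[OF assms(4) _ _ assms(1-3)] unfolding isomorphic_def by blast
qed

end
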